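(* Let $(R,\triangleright)$ be a rack. Let $\overline{R}=\{\overline{a}:\ a\in R\}$, and let $*$ be the binary operation on $\overline{R}$ given by $\overline{a}*\overline{b}=\overline{a\triangleright b}$ for $a,b\in R$. Then $(\overline{R},* )$ is a quandle (in particular, $*$ is well defined).
   Context: A rack is a set $R$ with a binary operation $\triangleright$ such that (i) $a\triangleright(b\triangleright c)=(a\triangleright b)\triangleright(a\triangleright c)$ for all $a,b,c\in R$, and (ii) for all $a,b\in R$ there is a unique $c\in R$ with $a\triangleright c=b$. A quandle is a rack in which $a\triangleright a=a$ for all $a$. A subset $Q\subseteq R$ is a subrack if $(Q,\triangleright)$ is a rack. For $a\in R$, $\ll a\gg$ denotes the subrack generated by $a$, i.e. the intersection of all subracks of $R$ containing $a$. Define the equivalence relation $a\sim b$ on $R$ by $\ll a\gg=\ll b\gg$, and let $\overline{a}$ denote the equivalence class of $a$. *)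

theory Defs
  imports Main
begin

locale rack =
  fixes R :: "'a set" and tri :: "'a \<Rightarrow> 'a \<Rightarrow> 'a"  (infixr \<open>\<triangleright>\<close> 70)
  assumes closed: "\<lbrakk>a \<in> R; b \<in> R\<rbrakk> \<Longrightarrow> a \<triangleright> b \<in> R"
    and self_distrib:
      "\<lbrakk>a \<in> R; b \<in> R; c \<in> R\<rbrakk> \<Longrightarrow> a \<triangleright> (b \<triangleright> c) = (a \<triangleright> b) \<triangleright> (a \<triangleright> c)"
    and unique_left_division: "\<lbrakk>a \<in> R; b \<in> R\<rbrakk> \<Longrightarrow> \<exists>!c. c \<in> R \<and> a \<triangleright> c = b"

locale quandle = rack +
  assumes idem: "a \<in> R \<Longrightarrow> a \<triangleright> a = a"

definition subrack :: "'a set \<Rightarrow> 'a set \<Rightarrow> ('a \<Rightarrow> 'a \<Rightarrow> 'a) \<Rightarrow> bool"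
  where "subrack Q R tri \<longleftrightarrow> Q \<subseteq> R \<and> rack Q tri"

definition generated_subrack :: "'a set \<Rightarrow> ('a \<Rightarrow> 'a \<Rightarrow> 'a) \<Rightarrow> 'a \<Rightarrow> 'a set"
  where "generated_subrack R tri a = \<Inter>{Q. subrack Q R tri \<and> a \<in> Q}"

definition same_subrack_rel :: "'a set \<Rightarrow> ('a \<Rightarrow> 'a \<Rightarrow> 'a) \<Rightarrow> ('a \<times> 'a) set"
  where "same_subrack_rel R tri =
    {(a, b). a \<in> R \<and> b \<in> R \<and> generated_subrack R tri a = generated_subrack R tri b}"

lemma equiv_same_subrack_rel: "equiv R (same_subrack_rel R tri)"
  by (rule equivI) (auto simp: same_subrack_rel_def refl_on_def sym_def trans_def)

definition rack_class :: "'a set \<Rightarrow> ('a \<Rightarrow> 'a \<Rightarrow> 'a) \<Rightarrow> 'a \<Rightarrow> 'a set"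
  where "rack_class R tri a = same_subrack_rel R tri `` {a}"

definition rack_quotient :: "'a set \<Rightarrow> ('a \<Rightarrow> 'a \<Rightarrow> 'a) \<Rightarrow> 'a set set"
  where "rack_quotient R tri = R // same_subrack_rel R tri"

lemma rack_quotient_eq_image: "rack_quotient R tri = rack_class R tri ` R"
  by (auto simp: rack_quotient_def rack_class_def quotient_def)

text \<open>
  The description below determines a value only if the class of \<open>a \<triangleright> b\<close> does not depend on the
  representatives \<open>a\<close> of \<open>A\<close> and \<open>b\<close> of \<open>B\<close>.
\<close>

definition quotient_op :: "'a set \<Rightarrow> ('a \<Rightarrow> 'a \<Rightarrow> 'a) \<Rightarrow> 'a set \<Rightarrow> 'a set \<Rightarrow> 'a set"
  where "quotient_op R tri A B =
    (THE C. \<exists>a\<in>R. \<exists>b\<in>R. A = rack_class R tri a \<and> B = rack_class R tri b \<and>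
                       C = rack_class R tri (tri a b))"

end

theory Submission
  imports Defs
begin

text \<open>
  Two facts about the left multiplications \<open>L\<^sub>a = (\<lambda>x. a \<triangleright> x)\<close> carry the proof. Each \<open>L\<^sub>a\<close>
  is an automorphism of the rack by self-distributivity and unique division, so it carries
  subracks to subracks in both directions; hence \<open>x \<sim> y\<close> if and only if \<open>a \<triangleright> x \<sim> a \<triangleright> y\<close>
  (\<open>same_subrack_rel_left_mult_iff\<close>). Moreover, self-distributivity says that
  \<open>L\<^bsub>x \<triangleright> y\<^esub> = L\<^sub>x L\<^sub>y L\<^sub>x\<inverse>\<close>, so the elements whose left multiplication equals a given \<open>L\<^sub>a\<close>
  form a subrack. That subrack contains \<open>a\<close>, so \<open>L\<^sub>x = L\<^sub>a\<close> for every \<open>x\<close> in the subrack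
  generated by \<open>a\<close> (\<open>left_mult_constant_on_generated_subrack\<close>).

  The operation on classes is therefore well defined: passing to an equivalent left factor does
  not change the product at all, and passing to an equivalent right factor changes it to
  an equivalent element. Self-distributivity and the existence of left quotients are inherited
  from the rack, and left quotients are unique because \<open>L\<^sub>a\<close> reflects \<open>\<sim>\<close>. Finally, \<open>a \<triangleright> a\<close> has
  the same left multiplication as \<open>a\<close>, so dividing \<open>a \<triangleright> a\<close> by itself gives \<open>a\<close> back; thus \<open>a\<close>
  and \<open>a \<triangleright> a\<close> generate the same subrack, which is idempotence.
\<close>

context rack
begin

section \<open>Subracks and the elements they separate\<close>

lemma left_cancel:
  assumes "a \<in> R" "x \<in> R" "y \<in> R"
  shows "a \<triangleright> x = a \<triangleright> y \<longleftrightarrow> x = y"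
  using unique_left_division[of a "a \<triangleright> y"] assms closed by auto

lemma left_quotient:
  assumes "a \<in> R" "b \<in> R"
  obtains c where "c \<in> R" "a \<triangleright> c = b"
  using unique_left_division assms by blast

text \<open>
  Closure under the product and closure under left division are the two directions of one
  equivalence. In this form subracks are visibly stable under intersections and under
  automorphisms, and quotients never have to be named.
\<close>

lemma subrack_iff:
  "subrack Q R (\<triangleright>) \<longleftrightarrow> Q \<subseteq> R \<and> (\<forall>x\<in>Q. \<forall>c\<in>R. x \<triangleright> c \<in> Q \<longleftrightarrow> c \<in> Q)"
proof (intro iffI conjI ballI)
  assume Q: "subrack Q R (\<triangleright>)"
  then show sub: "Q \<subseteq> R" by (simp add: subrack_def)
  interpret Q: rack Q "(\<triangleright>)" using Q by (simp add: subrack_def)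
  fix x c assume x: "x \<in> Q" and c: "c \<in> R"
  show "x \<triangleright> c \<in> Q" if "c \<in> Q" using Q.closed x that .
  show "c \<in> Q" if prod: "x \<triangleright> c \<in> Q"
  proof -
    obtain d where "d \<in> Q" "x \<triangleright> d = x \<triangleright> c"
      using Q.left_quotient[OF x prod] .
    then show ?thesis using left_cancel[of x d c] x c sub by auto
  qed
next
  assume Q: "Q \<subseteq> R \<and> (\<forall>x\<in>Q. \<forall>c\<in>R. x \<triangleright> c \<in> Q \<longleftrightarrow> c \<in> Q)"
  have "rack Q (\<triangleright>)"
  proof
    show "a \<triangleright> b \<in> Q" if "a \<in> Q" "b \<in> Q" for a b
      using Q that by blast
    show "a \<triangleright> (b \<triangleright> c) = (a \<triangleright> b) \<triangleright> (a \<triangleright> c)" if "a \<in> Q" "b \<in> Q" "c \<in> Q" for a b c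
      using self_distrib Q that by blast
    show "\<exists>!c. c \<in> Q \<and> a \<triangleright> c = b" if a: "a \<in> Q" and b: "b \<in> Q" for a b
      using unique_left_division[of a b] Q a b by (metis subsetD)
  qed
  then show "subrack Q R (\<triangleright>)" using Q by (simp add: subrack_def)
qed

lemma mem_generated_subrack_iff:
  "x \<in> generated_subrack R (\<triangleright>) a \<longleftrightarrow> (\<forall>Q. subrack Q R (\<triangleright>) \<and> a \<in> Q \<longrightarrow> x \<in> Q)"
  by (auto simp: generated_subrack_def)

lemma generator_mem: "a \<in> generated_subrack R (\<triangleright>) a"
  by (simp add: mem_generated_subrack_iff)

text \<open>
  A subrack contains an element if and only if it contains the subrack generated by that
  element, so two elements generate the same subrack exactly when no subrack separates them. This reduces statements
  about \<open>\<sim>\<close> to membership in a single arbitrary subrack.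
\<close>

lemma same_subrack_rel_iff:
  "(x, y) \<in> same_subrack_rel R (\<triangleright>) \<longleftrightarrow>
     x \<in> R \<and> y \<in> R \<and> (\<forall>Q. subrack Q R (\<triangleright>) \<longrightarrow> (x \<in> Q \<longleftrightarrow> y \<in> Q))"
proof -
  have "generated_subrack R (\<triangleright>) x = generated_subrack R (\<triangleright>) y \<longleftrightarrow>
      (\<forall>Q. subrack Q R (\<triangleright>) \<longrightarrow> (x \<in> Q \<longleftrightarrow> y \<in> Q))"
    using generator_mem[of x] generator_mem[of y]
    by (auto simp: set_eq_iff mem_generated_subrack_iff)
  then show ?thesis by (simp add: same_subrack_rel_def)
qed

section \<open>Left multiplications as automorphisms\<close>

lemma subrack_left_mult_vimage:
  assumes a: "a \<in> R" and Q: "subrack Q R (\<triangleright>)"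
  shows "subrack {x \<in> R. a \<triangleright> x \<in> Q} R (\<triangleright>)"
  unfolding subrack_iff
proof (intro conjI ballI)
  fix x c
  assume x: "x \<in> {x \<in> R. a \<triangleright> x \<in> Q}" and c: "c \<in> R"
  then have "a \<triangleright> (x \<triangleright> c) = (a \<triangleright> x) \<triangleright> (a \<triangleright> c)"
    using self_distrib[OF a, of x c] by simp
  then show "x \<triangleright> c \<in> {x \<in> R. a \<triangleright> x \<in> Q} \<longleftrightarrow> c \<in> {x \<in> R. a \<triangleright> x \<in> Q}"
    using Q x c closed a by (simp add: subrack_iff)
qed auto

lemma subrack_left_mult_image:
  assumes a: "a \<in> R" and Q: "subrack Q R (\<triangleright>)"
  shows "subrack ((\<triangleright>) a ` Q) R (\<triangleright>)"
proof -
  have sub: "Q \<subseteq> R" using Q by (simp add: subrack_iff)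
  have mem: "a \<triangleright> x \<in> (\<triangleright>) a ` Q \<longleftrightarrow> x \<in> Q" if "x \<in> R" for x
    using left_cancel[OF a that] sub by blast
  show ?thesis
    unfolding subrack_iff
  proof (intro conjI ballI)
    show "(\<triangleright>) a ` Q \<subseteq> R" using a sub closed by blast
    fix u c assume "u \<in> (\<triangleright>) a ` Q" and c: "c \<in> R"
    then obtain x where x: "x \<in> Q" "x \<in> R" "u = a \<triangleright> x" using sub by blast
    obtain d where d: "d \<in> R" "a \<triangleright> d = c" using left_quotient[OF a c] .
    have "u \<triangleright> c = a \<triangleright> (x \<triangleright> d)"
      using self_distrib[OF a x(2) d(1)] x(3) d(2) by simp
    then have "u \<triangleright> c \<in> (\<triangleright>) a ` Q \<longleftrightarrow> x \<triangleright> d \<in> Q"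
      using mem closed x(2) d(1) by simp
    also have "\<dots> \<longleftrightarrow> d \<in> Q"
      using Q x(1) d(1) by (simp add: subrack_iff)
    also have "\<dots> \<longleftrightarrow> c \<in> (\<triangleright>) a ` Q"
      using mem[OF d(1)] d(2) by simp
    finally show "u \<triangleright> c \<in> (\<triangleright>) a ` Q \<longleftrightarrow> c \<in> (\<triangleright>) a ` Q" .
  qed
qed

text \<open>
  A subrack that separates \<open>x\<close> from \<open>y\<close> has an image under \<open>L\<^sub>a\<close> that separates
  \<open>a \<triangleright> x\<close> from \<open>a \<triangleright> y\<close>, and preimages give the converse.
\<close>

lemma same_subrack_rel_left_mult_iff:
  assumes a: "a \<in> R" and x: "x \<in> R" and y: "y \<in> R"
  shows "(a \<triangleright> x, a \<triangleright> y) \<in> same_subrack_rel R (\<triangleright>) \<longleftrightarrow> (x, y) \<in> same_subrack_rel R (\<triangleright>)"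
proof
  assume rel: "(a \<triangleright> x, a \<triangleright> y) \<in> same_subrack_rel R (\<triangleright>)"
  have "x \<in> Q \<longleftrightarrow> y \<in> Q" if Q: "subrack Q R (\<triangleright>)" for Q
  proof -
    have sub: "Q \<subseteq> R" using Q by (simp add: subrack_iff)
    have "a \<triangleright> z \<in> (\<triangleright>) a ` Q \<longleftrightarrow> z \<in> Q" if "z \<in> R" for z
      using left_cancel[OF a that] sub by blast
    moreover have "a \<triangleright> x \<in> (\<triangleright>) a ` Q \<longleftrightarrow> a \<triangleright> y \<in> (\<triangleright>) a ` Q"
      using rel subrack_left_mult_image[OF a Q] unfolding same_subrack_rel_iff by blast
    ultimately show ?thesis using x y by simp
  qed
  then show "(x, y) \<in> same_subrack_rel R (\<triangleright>)"
    using x y by (simp add: same_subrack_rel_iff)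
next
  assume rel: "(x, y) \<in> same_subrack_rel R (\<triangleright>)"
  have "a \<triangleright> x \<in> Q \<longleftrightarrow> a \<triangleright> y \<in> Q" if Q: "subrack Q R (\<triangleright>)" for Q
  proof -
    have "x \<in> {z \<in> R. a \<triangleright> z \<in> Q} \<longleftrightarrow> y \<in> {z \<in> R. a \<triangleright> z \<in> Q}"
      using rel subrack_left_mult_vimage[OF a Q] unfolding same_subrack_rel_iff by blast
    then show ?thesis using x y by simp
  qed
  then show "(a \<triangleright> x, a \<triangleright> y) \<in> same_subrack_rel R (\<triangleright>)"
    using a x y closed by (simp add: same_subrack_rel_iff)
qed

section \<open>Left multiplications on one-generator subracks\<close>

text \<open>
  If \<open>L\<^sub>x = L\<^sub>a\<close>, then \<open>L\<^bsub>x \<triangleright> c\<^esub> = L\<^sub>a L\<^sub>c L\<^sub>a\<inverse>\<close>, and this conjugate equals \<open>L\<^sub>a\<close> exactly when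
  \<open>L\<^sub>c = L\<^sub>a\<close>. The proof evaluates at the points \<open>a \<triangleright> d\<close>, which exhaust \<open>R\<close>, to avoid inverses.
\<close>

lemma subrack_same_left_mult:
  assumes a: "a \<in> R"
  shows "subrack {x \<in> R. \<forall>y\<in>R. x \<triangleright> y = a \<triangleright> y} R (\<triangleright>)"
  unfolding subrack_iff
proof (intro conjI ballI)
  fix x c
  assume "x \<in> {x \<in> R. \<forall>y\<in>R. x \<triangleright> y = a \<triangleright> y}" and c: "c \<in> R"
  then have x: "x \<in> R" and xa: "\<And>y. y \<in> R \<Longrightarrow> x \<triangleright> y = a \<triangleright> y" by auto
  have "(\<forall>y\<in>R. (x \<triangleright> c) \<triangleright> y = a \<triangleright> y) \<longleftrightarrow>
      (\<forall>d\<in>R. (x \<triangleright> c) \<triangleright> (a \<triangleright> d) = a \<triangleright> (a \<triangleright> d))"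
    using left_quotient[OF a] closed[OF a] by metis
  also have "\<dots> \<longleftrightarrow> (\<forall>d\<in>R. a \<triangleright> (c \<triangleright> d) = a \<triangleright> (a \<triangleright> d))"
    using self_distrib[OF a c] xa[OF c] by simp
  also have "\<dots> \<longleftrightarrow> (\<forall>d\<in>R. c \<triangleright> d = a \<triangleright> d)"
    using left_cancel[OF a] closed a c by simp
  finally show "x \<triangleright> c \<in> {x \<in> R. \<forall>y\<in>R. x \<triangleright> y = a \<triangleright> y} \<longleftrightarrow>
      c \<in> {x \<in> R. \<forall>y\<in>R. x \<triangleright> y = a \<triangleright> y}"
    using closed[OF x c] c by simp
qed auto

lemma left_mult_constant_on_generated_subrack:
  assumes "a \<in> R" "x \<in> generated_subrack R (\<triangleright>) a" "y \<in> R"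
  shows "x \<triangleright> y = a \<triangleright> y"
proof -
  have "x \<in> {x \<in> R. \<forall>y\<in>R. x \<triangleright> y = a \<triangleright> y}"
    using assms(2) subrack_same_left_mult[OF assms(1)] assms(1)
    unfolding mem_generated_subrack_iff by blast
  then show ?thesis using assms(3) by simp
qed

lemma same_subrack_rel_mult:
  assumes aa': "(a, a') \<in> same_subrack_rel R (\<triangleright>)" and bb': "(b, b') \<in> same_subrack_rel R (\<triangleright>)"
  shows "(a \<triangleright> b, a' \<triangleright> b') \<in> same_subrack_rel R (\<triangleright>)"
proof -
  have mem: "a \<in> R" "a' \<in> R" "b \<in> R" "b' \<in> R"
    using aa' bb' by (auto simp: same_subrack_rel_iff)
  have "a' \<in> generated_subrack R (\<triangleright>) a"
    using aa' generator_mem[of a'] by (simp add: same_subrack_rel_def)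
  then have "a' \<triangleright> b' = a \<triangleright> b'"
    using left_mult_constant_on_generated_subrack mem by simp
  then show ?thesis
    using same_subrack_rel_left_mult_iff mem bb' by simp
qed

text \<open>
  Left multiplication by \<open>a \<triangleright> a\<close> is \<open>L\<^sub>a\<close>, so \<open>(a \<triangleright> a) \<triangleright> a = a \<triangleright> a\<close>: a subrack containing
  \<open>a \<triangleright> a\<close> contains \<open>a\<close> as a left quotient.
\<close>

lemma same_subrack_rel_square:
  assumes a: "a \<in> R"
  shows "(a \<triangleright> a, a) \<in> same_subrack_rel R (\<triangleright>)"
proof -
  have closed_div: "x \<triangleright> c \<in> Q \<longleftrightarrow> c \<in> Q" if "subrack Q R (\<triangleright>)" "x \<in> Q" "c \<in> R" for x c Q
    using that by (simp add: subrack_iff)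
  have "a \<triangleright> a \<in> generated_subrack R (\<triangleright>) a"
    using closed_div a by (simp add: mem_generated_subrack_iff)
  then have "(a \<triangleright> a) \<triangleright> a = a \<triangleright> a"
    using left_mult_constant_on_generated_subrack a by simp
  then have "a \<triangleright> a \<in> Q \<longleftrightarrow> a \<in> Q" if "subrack Q R (\<triangleright>)" for Q
    using closed_div[OF that] a by metis
  then show ?thesis
    using a closed by (simp add: same_subrack_rel_iff)
qed

section \<open>The quotient quandle\<close>

lemma rack_class_eq_iff:
  assumes "a \<in> R" "b \<in> R"
  shows "rack_class R (\<triangleright>) a = rack_class R (\<triangleright>) b \<longleftrightarrow> (a, b) \<in> same_subrack_rel R (\<triangleright>)"
  unfolding rack_class_def
  using eq_equiv_class_iff[OF equiv_same_subrack_rel assms] .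

lemma quotient_op_rack_class:
  assumes a: "a \<in> R" and b: "b \<in> R"
  shows "quotient_op R (\<triangleright>) (rack_class R (\<triangleright>) a) (rack_class R (\<triangleright>) b) = rack_class R (\<triangleright>) (a \<triangleright> b)"
  unfolding quotient_op_def
proof (rule the_equality)
  fix C
  assume "\<exists>a'\<in>R. \<exists>b'\<in>R. rack_class R (\<triangleright>) a = rack_class R (\<triangleright>) a' \<and>
    rack_class R (\<triangleright>) b = rack_class R (\<triangleright>) b' \<and> C = rack_class R (\<triangleright>) (a' \<triangleright> b')"
  then obtain a' b' where *: "a' \<in> R" "b' \<in> R"
    "(a, a') \<in> same_subrack_rel R (\<triangleright>)" "(b, b') \<in> same_subrack_rel R (\<triangleright>)"
    "C = rack_class R (\<triangleright>) (a' \<triangleright> b')"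
    using rack_class_eq_iff a b by blast
  then show "C = rack_class R (\<triangleright>) (a \<triangleright> b)"
    using same_subrack_rel_mult[OF *(3,4)] rack_class_eq_iff closed a b by metis
qed (use a b in blast)

lemma quandle_rack_quotient: "quandle (rack_quotient R (\<triangleright>)) (quotient_op R (\<triangleright>))"
  unfolding rack_quotient_eq_image
proof
  let ?cl = "rack_class R (\<triangleright>)" and ?op = "quotient_op R (\<triangleright>)"
  show "?op A B \<in> ?cl ` R" if "A \<in> ?cl ` R" "B \<in> ?cl ` R" for A B
    using that closed by (auto simp: quotient_op_rack_class)
  show "?op A (?op B C) = ?op (?op A B) (?op A C)"
    if ABC: "A \<in> ?cl ` R" "B \<in> ?cl ` R" "C \<in> ?cl ` R" for A B C
  proof -
    obtain a b c where "a \<in> R" "b \<in> R" "c \<in> R" "A = ?cl a" "B = ?cl b" "C = ?cl c"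
      using ABC by blast
    then show ?thesis
      using self_distrib[of a b c] closed by (simp add: quotient_op_rack_class)
  qed
  show "?op A A = A" if A: "A \<in> ?cl ` R" for A
  proof -
    obtain a where a: "a \<in> R" "A = ?cl a" using A by blast
    then have "?cl (a \<triangleright> a) = ?cl a"
      using closed by (simp add: rack_class_eq_iff same_subrack_rel_square)
    then show ?thesis using a by (simp add: quotient_op_rack_class)
  qed
  show "\<exists>!C. C \<in> ?cl ` R \<and> ?op A C = B" if AB: "A \<in> ?cl ` R" "B \<in> ?cl ` R" for A B
  proof -
    obtain a b where ab: "a \<in> R" "A = ?cl a" "b \<in> R" "B = ?cl b" using AB by blast
    obtain c where c: "c \<in> R" "a \<triangleright> c = b" using left_quotient[OF ab(1,3)] .
    show ?thesis
    proof (rule ex1I[of _ "?cl c"])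
      show "?cl c \<in> ?cl ` R \<and> ?op A (?cl c) = B"
        using ab c by (simp add: quotient_op_rack_class)
      fix D assume "D \<in> ?cl ` R \<and> ?op A D = B"
      then obtain d where d: "d \<in> R" "D = ?cl d" "?cl (a \<triangleright> d) = ?cl (a \<triangleright> c)"
        using ab c by (auto simp: quotient_op_rack_class)
      then have "(d, c) \<in> same_subrack_rel R (\<triangleright>)"
        using same_subrack_rel_left_mult_iff rack_class_eq_iff closed ab(1) c(1) by simp
      then show "D = ?cl c"
        using rack_class_eq_iff d c(1) by simp
    qed
  qed
qed

end

theorem theorem2p4:
  fixes R :: "'a set" and tri :: "'a \<Rightarrow> 'a \<Rightarrow> 'a"  (infixr \<open>\<triangleright>\<close> 70)
  assumes "rack R (\<triangleright>)"
  shows "(\<lambda>a b. rack_class R (\<triangleright>) (a \<triangleright> b)) respects2 same_subrack_rel R (\<triangleright>)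
    \<and> (\<forall>a\<in>R. \<forall>b\<in>R. quotient_op R (\<triangleright>) (rack_class R (\<triangleright>) a) (rack_class R (\<triangleright>) b)
                       = rack_class R (\<triangleright>) (a \<triangleright> b))
    \<and> quandle (rack_quotient R (\<triangleright>)) (quotient_op R (\<triangleright>))"
proof -
  interpret rack R "(\<triangleright>)" by fact
  have "rack_class R (\<triangleright>) (a \<triangleright> b) = rack_class R (\<triangleright>) (a' \<triangleright> b')"
    if "(a, a') \<in> same_subrack_rel R (\<triangleright>)" "(b, b') \<in> same_subrack_rel R (\<triangleright>)" for a a' b b'
    using same_subrack_rel_mult[OF that]
    by (simp add: rack_class_eq_iff same_subrack_rel_iff)
  then show ?thesis
    by (auto simp: congruent2_def quotient_op_rack_class quandle_rack_quotient)
qed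

end
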